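(* Let $l,m\ge1$ be integers, $n=l+m+2$, $x_0>0$, $Y_0>0$, and let $\tilde H:[0,Y_0]\to\mathbb{R}$ be a (measurable) function. (i) If $\tilde H$ is bounded, then there exist constants $M>0$ and $Y\in(0,Y_0]$ such that the integral equation $$q(y)=y^{-m}\int_0^y\left\{-m\,q(\eta)^3+(n-1)\tilde H(\eta)\,\eta\,(1+q(\eta)^2)^{3/2}+l\,\frac{\eta\,(1+q(\eta)^2)}{\int_0^\eta q(\xi)\,d\xi+x_0}\right\}\eta^{m-1}\,d\eta,\qquad y\in(0,Y],$$ has a unique solution $q$ in $X_{Y,M}$. (ii) If $\tilde H$ is bounded and continuous, then the solution $q$ obtained in (i) is a unique solution of the singular initial value problem $$y\frac{dq}{dy}=-mq-mq^3+(n-1)\tilde H(y)\,y\,(1+q^2)^{3/2}+l\,\frac{y(1+q^2)}{\int_0^y q(\xi)\,d\xi+x_0}\quad(0<y\le Y),\qquad q(0)=0.$$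
   Context: For $Y,M>0$: $\|q\|_X=\sup_{y\in(0,Y]}|q(y)/y|$, $X_Y=\{q\in C((0,Y]): \|q\|_X<\infty\}$, a Banach space, and $X_{Y,M}=\{q\in X_Y:\|q\|_X\le M\}$. Every $q\in X_Y$ is extended continuously to $[0,Y]$ by $q(0)=0$. A solution of the integral equation is understood to have $\int_0^\eta q(\xi)\,d\xi+x_0\neq0$ for $\eta\in[0,Y]$. A solution of the initial value problem is a continuous function on $[0,Y]$, differentiable on $(0,Y]$, with $\int_0^y q(\xi)\,d\xi+x_0\ne 0$ on $[0,Y]$, satisfying the equation on $(0,Y]$ and $q(0)=0$. (The number $x_0$ is the value $x(0)>0$ of the $x$-coordinate at the point where the generating curve meets the $x$-axis, $y(0)=0$.) *)

theory Defs
  imports "HOL-Analysis.Analysis"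
begin

text \<open>
  Functions on \<open>(0,Y]\<close> or \<open>[0,Y]\<close> are represented by total functions \<open>real \<Rightarrow> real\<close> whose
  values outside \<open>[0,Y]\<close> are irrelevant; accordingly, uniqueness below means equality on \<open>[0,Y]\<close>.
  The convention \<open>q(0) = 0\<close> for elements of the space is part of its definition.
\<close>

definition X_norm :: "real \<Rightarrow> (real \<Rightarrow> real) \<Rightarrow> real" where
  "X_norm Y q = (SUP y\<in>{0<..Y}. \<bar>q y / y\<bar>)"

definition X_space :: "real \<Rightarrow> (real \<Rightarrow> real) set" where
  "X_space Y = {q. q 0 = 0 \<and> continuous_on {0<..Y} q \<and>
                   bdd_above ((\<lambda>y. \<bar>q y / y\<bar>) ` {0<..Y})}"

definition X_ball :: "real \<Rightarrow> real \<Rightarrow> (real \<Rightarrow> real) set" where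
  "X_ball Y M = {q \<in> X_space Y. X_norm Y q \<le> M}"

text \<open>Integrals are taken over \<open>lebesgue\<close>, since \<open>H\<close> is only assumed Lebesgue measurable.\<close>

definition x_coord :: "real \<Rightarrow> (real \<Rightarrow> real) \<Rightarrow> real \<Rightarrow> real" where
  "x_coord x0 q y = (LINT \<xi>:{0..y}|lebesgue. q \<xi>) + x0"

text \<open>The expression in braces in the integral equation.\<close>

definition braces ::
  "nat \<Rightarrow> nat \<Rightarrow> nat \<Rightarrow> real \<Rightarrow> (real \<Rightarrow> real) \<Rightarrow> (real \<Rightarrow> real) \<Rightarrow> real \<Rightarrow> real" where
  "braces l m n x0 H q y =
     - real m * q y ^ 3
     + (real n - 1) * H y * y * (1 + (q y)\<^sup>2) powr (3/2)
     + real l * (y * (1 + (q y)\<^sup>2) / x_coord x0 q y)"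

definition integral_eq_solution ::
  "nat \<Rightarrow> nat \<Rightarrow> nat \<Rightarrow> real \<Rightarrow> (real \<Rightarrow> real) \<Rightarrow> real \<Rightarrow> (real \<Rightarrow> real) \<Rightarrow> bool" where
  "integral_eq_solution l m n x0 H Y q \<longleftrightarrow>
     (\<forall>\<eta>\<in>{0..Y}. x_coord x0 q \<eta> \<noteq> 0) \<and>
     (\<forall>y\<in>{0<..Y}.
        q y = inverse (y ^ m) *
              (LINT \<eta>:{0..y}|lebesgue. braces l m n x0 H q \<eta> * \<eta> ^ (m - 1)))"

definition ivp_solution ::
  "nat \<Rightarrow> nat \<Rightarrow> nat \<Rightarrow> real \<Rightarrow> (real \<Rightarrow> real) \<Rightarrow> real \<Rightarrow> (real \<Rightarrow> real) \<Rightarrow> bool" where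
  "ivp_solution l m n x0 H Y q \<longleftrightarrow>
     continuous_on {0..Y} q \<and>
     (\<forall>y\<in>{0..Y}. x_coord x0 q y \<noteq> 0) \<and>
     (\<forall>y\<in>{0<..Y}. \<exists>d. (q has_real_derivative d) (at y within {0..Y}) \<and>
        y * d = - real m * q y + braces l m n x0 H q y) \<and>
     q 0 = 0"

definition unique_integral_eq_solution ::
  "nat \<Rightarrow> nat \<Rightarrow> nat \<Rightarrow> real \<Rightarrow> (real \<Rightarrow> real) \<Rightarrow> real \<Rightarrow> real \<Rightarrow> (real \<Rightarrow> real) \<Rightarrow> bool" where
  "unique_integral_eq_solution l m n x0 H Y M q \<longleftrightarrow>
     q \<in> X_ball Y M \<and> integral_eq_solution l m n x0 H Y q \<and>
     (\<forall>p\<in>X_ball Y M. integral_eq_solution l m n x0 H Y p \<longrightarrow> (\<forall>y\<in>{0..Y}. p y = q y))"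

text \<open>Competitors here are all solutions on \<open>[0,Y]\<close>, not only those in \<open>X_ball Y M\<close>.\<close>

definition unique_ivp_solution ::
  "nat \<Rightarrow> nat \<Rightarrow> nat \<Rightarrow> real \<Rightarrow> (real \<Rightarrow> real) \<Rightarrow> real \<Rightarrow> (real \<Rightarrow> real) \<Rightarrow> bool" where
  "unique_ivp_solution l m n x0 H Y q \<longleftrightarrow>
     ivp_solution l m n x0 H Y q \<and>
     (\<forall>p. ivp_solution l m n x0 H Y p \<longrightarrow> (\<forall>y\<in>{0..Y}. p y = q y))"

end

theory Submission
  imports Defs
begin

text \<open>
  Write the expression in braces as \<open>-m q\<^sup>3 + y G\<close>, where \<open>G\<close> is Lipschitz in \<open>q\<close> and in the
  \<open>x\<close>-coordinate as long as \<open>q\<close> is bounded and the \<open>x\<close>-coordinate is bounded away from \<open>0\<close>. For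
  \<open>|q(y)| \<le> M y\<close> the expression is \<open>O(y)\<close>, and for small \<open>Y\<close> the right-hand side of the integral
  equation maps the ball into itself and contracts the supremum norm, which gives (i). For (ii),
  differentiating the integral equation gives the differential equation. Two solutions \<open>p, q\<close> of the
  initial value problem are compared at a maximum \<open>z\<close> of \<open>(p - q)\<^sup>2 exp (-\<kappa> y)\<close>: there
  \<open>|p - q| \<le> |p(z) - q(z)|\<close> on \<open>[0,z]\<close>, which controls the nonlocal term, and the singular terms
  \<open>-m q - m q\<^sup>3\<close> are monotone and have the right sign. For large \<open>\<kappa>\<close> the derivative at \<open>z\<close> would
  be negative, so \<open>p = q\<close>.
\<close>

section \<open>Lipschitz bounds for the nonlinear terms\<close>

text \<open>Mean value bound: on \<open>{-R..R}\<close> the absolute value of the derivative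
  \<open>3 * z * (1 + z\<^sup>2) powr (1/2)\<close> is largest at the endpoints.\<close>

lemma one_plus_square_powr_lipschitz:
  fixes p q R :: real
  assumes "\<bar>p\<bar> \<le> R" "\<bar>q\<bar> \<le> R"
  shows "\<bar>(1 + p\<^sup>2) powr (3/2) - (1 + q\<^sup>2) powr (3/2)\<bar> \<le> 3 * R * (1 + R\<^sup>2) powr (1/2) * \<bar>p - q\<bar>"
proof -
  have "norm ((1 + p\<^sup>2) powr (3/2) - (1 + q\<^sup>2) powr (3/2))
          \<le> 3 * R * (1 + R\<^sup>2) powr (1/2) * norm (p - q)"
  proof (rule field_differentiable_bound[where S = "{-R..R}"])
    fix z :: real assume z: "z \<in> {-R..R}"
    have pos: "1 + z\<^sup>2 > 0" by (simp add: add_pos_nonneg)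
    show "((\<lambda>z. (1 + z\<^sup>2) powr (3/2)) has_field_derivative 3 * z * (1 + z\<^sup>2) powr (1/2))
            (at z within {-R..R})"
      using pos by (auto intro!: derivative_eq_intros)
    have "z\<^sup>2 \<le> R\<^sup>2" using z by (auto intro!: power2_le_iff_abs_le[THEN iffD2])
    then have "(1 + z\<^sup>2) powr (1/2) \<le> (1 + R\<^sup>2) powr (1/2)" 
      using pos by (intro powr_mono2) auto
    then show "norm (3 * z * (1 + z\<^sup>2) powr (1/2)) \<le> 3 * R * (1 + R\<^sup>2) powr (1/2)"
      using z by (auto simp: abs_mult intro!: mult_mono)
  qed (use assms in auto)
  then show ?thesis by simp
qed

lemma quotient_lipschitz:
  fixes p q R c X Z :: real
  assumes p: "\<bar>p\<bar> \<le> R" and q: "\<bar>q\<bar> \<le> R" and c: "c > 0" and X: "X \<ge> c" and Z: "Z \<ge> c"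
  shows "\<bar>(1 + p\<^sup>2) / X - (1 + q\<^sup>2) / Z\<bar> \<le> 2 * R / c * \<bar>p - q\<bar> + (1 + R\<^sup>2) / c\<^sup>2 * \<bar>X - Z\<bar>"
proof -
  have pos: "X > 0" "Z > 0" using c X Z by auto
  \<comment> \<open>First the numerator changes over the fixed denominator \<open>X\<close>, then
    the denominator changes under the fixed numerator \<open>1 + q\<^sup>2\<close>.\<close>
  have "(1 + p\<^sup>2) / X - (1 + q\<^sup>2) / Z = (p + q) / X * (p - q) - (1 + q\<^sup>2) / (X * Z) * (X - Z)"
    using pos by (simp add: field_simps power2_eq_square)
  also have "\<bar>\<dots>\<bar> \<le> \<bar>p + q\<bar> / X * \<bar>p - q\<bar> + (1 + q\<^sup>2) / (X * Z) * \<bar>X - Z\<bar>"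
    using pos by (intro order.trans[OF abs_triangle_ineq4] add_mono) (simp_all add: abs_mult)
  also have "\<dots> \<le> 2 * R / c * \<bar>p - q\<bar> + (1 + R\<^sup>2) / c\<^sup>2 * \<bar>X - Z\<bar>"
  proof (intro add_mono mult_right_mono frac_le)
    show "c\<^sup>2 \<le> X * Z" using c X Z by (simp add: power2_eq_square mult_mono)
    show "q\<^sup>2 \<le> R\<^sup>2" using q p by (simp add: abs_le_square_iff[symmetric])
  qed (use p q c X in auto)
  finally show ?thesis .
qed

text \<open>The part of \<open>braces\<close> that carries a factor \<open>y\<close>, divided by \<open>y\<close>; \<open>h\<close> and \<open>X\<close> stand for the
  values of \<open>H\<close> and of the \<open>x\<close>-coordinate.\<close>

definition braces_regular :: "nat \<Rightarrow> nat \<Rightarrow> real \<Rightarrow> real \<Rightarrow> real \<Rightarrow> real" where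
  "braces_regular l n h p X =
     (real n - 1) * h * (1 + p\<^sup>2) powr (3/2) + real l * ((1 + p\<^sup>2) / X)"

lemma braces_eq:
  "braces l m n x0 H q y =
     - real m * q y ^ 3 + y * braces_regular l n (H y) (q y) (x_coord x0 q y)"
  by (simp add: braces_def braces_regular_def algebra_simps)

text \<open>One constant \<open>L\<close> serves all \<open>h\<close> bounded by \<open>B\<close>,
  hence all points y at once. It is used with \<open>R = 1\<close>, \<open>c = x0 / 2\<close> for
  existence, and with bounds taken from two given solutions for uniqueness.\<close>

lemma braces_regular_lipschitz:
  fixes R B c :: real
  assumes "c > 0" "R \<ge> 0" "B \<ge> 0"
  obtains L where "L \<ge> 0"
    "\<And>h p q X Z. \<lbrakk>\<bar>h\<bar> \<le> B; \<bar>p\<bar> \<le> R; \<bar>q\<bar> \<le> R; X \<ge> c; Z \<ge> c\<rbrakk> \<Longrightarrow>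
       \<bar>braces_regular l n h p X - braces_regular l n h q Z\<bar> \<le> L * (\<bar>p - q\<bar> + \<bar>X - Z\<bar>)"
proof
  define L1 where "L1 = 3 * R * (1 + R\<^sup>2) powr (1/2)"
  define L2 where "L2 = 2 * R / c"
  define L3 where "L3 = (1 + R\<^sup>2) / c\<^sup>2"
  define N where "N = \<bar>real n - 1\<bar> * B"
  have nonneg: "L1 \<ge> 0" "L2 \<ge> 0" "L3 \<ge> 0" "N \<ge> 0"
    using assms by (auto simp: L1_def L2_def L3_def N_def)
  show "N * L1 + real l * L2 + real l * L3 \<ge> 0" using nonneg by simp
  fix h p q X Z :: real
  assume *: "\<bar>h\<bar> \<le> B" "\<bar>p\<bar> \<le> R" "\<bar>q\<bar> \<le> R" "X \<ge> c" "Z \<ge> c"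
  define a where "a = (1 + p\<^sup>2) powr (3/2) - (1 + q\<^sup>2) powr (3/2)"
  define b where "b = (1 + p\<^sup>2) / X - (1 + q\<^sup>2) / Z"
  have a: "\<bar>a\<bar> \<le> L1 * \<bar>p - q\<bar>"
    using one_plus_square_powr_lipschitz[OF *(2,3)] by (simp add: a_def L1_def)
  have b: "\<bar>b\<bar> \<le> L2 * \<bar>p - q\<bar> + L3 * \<bar>X - Z\<bar>"
    using quotient_lipschitz[OF *(2,3) assms(1) *(4,5)] by (simp add: b_def L2_def L3_def)
  have "braces_regular l n h p X - braces_regular l n h q Z = (real n - 1) * h * a + real l * b"
    by (simp add: braces_regular_def a_def b_def algebra_simps)
  also have "\<bar>\<dots>\<bar> \<le> \<bar>real n - 1\<bar> * \<bar>h\<bar> * \<bar>a\<bar> + real l * \<bar>b\<bar>"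
    by (intro order.trans[OF abs_triangle_ineq]) (simp add: abs_mult)
  also have "\<dots> \<le> N * (L1 * \<bar>p - q\<bar>) + real l * (L2 * \<bar>p - q\<bar> + L3 * \<bar>X - Z\<bar>)"
    unfolding N_def using a b * by (intro add_mono mult_mono) auto
  also have "\<dots> \<le> (N * L1 + real l * L2 + real l * L3) * (\<bar>p - q\<bar> + \<bar>X - Z\<bar>)"
    using nonneg by (simp add: algebra_simps)
  finally show "\<bar>braces_regular l n h p X - braces_regular l n h q Z\<bar>
      \<le> (N * L1 + real l * L2 + real l * L3) * (\<bar>p - q\<bar> + \<bar>X - Z\<bar>)" .
qed

section \<open>The x-coordinate as a nonlocal function of q\<close>

lemma x_coord_eq_integral:
  assumes "continuous_on {0..Y} q" "y \<in> {0..Y}"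
  shows "x_coord x0 q y = integral {0..y} q + x0"
proof -
  have "continuous_on {0..y} q" using assms by (auto intro: continuous_on_subset)
  then show ?thesis
    unfolding x_coord_def
    by (simp add: set_lebesgue_integral_eq_integral(2) absolutely_integrable_continuous_real)
qed

lemma continuous_on_x_coord:
  assumes "continuous_on {0..Y} q"
  shows "continuous_on {0..Y} (x_coord x0 q)"
proof -
  have "continuous_on {0..Y} (\<lambda>y. integral {0..y} q + x0)"
    using assms by (intro continuous_intros indefinite_integral_continuous_1 integrable_continuous_interval)
  then show ?thesis
    using x_coord_eq_integral[OF assms] by (subst continuous_on_cong[OF refl]) auto
qed

text \<open>Controls the nonlocal term. Only values on \<open>{0..y}\<close> enter, which is what
  the comparison at a maximum point needs.\<close>

lemma x_coord_diff_le:
  assumes p: "continuous_on {0..Y} p" and q: "continuous_on {0..Y} q" and y: "y \<in> {0..Y}"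
    and D: "\<And>s. s \<in> {0..y} \<Longrightarrow> \<bar>p s - q s\<bar> \<le> D"
  shows "\<bar>x_coord x0 p y - x_coord x0 q y\<bar> \<le> D * y"
proof -
  have c: "continuous_on {0..y} p" "continuous_on {0..y} q"
    using p q y by (auto intro: continuous_on_subset)
  have "x_coord x0 p y - x_coord x0 q y = integral {0..y} (\<lambda>s. p s - q s)"
    using c by (simp add: x_coord_eq_integral[OF p y] x_coord_eq_integral[OF q y]
        integral_diff integrable_continuous_interval)
  also have "norm \<dots> \<le> D * (y - 0)"
    using c y D by (intro integral_bound continuous_intros) auto
  finally show ?thesis by simp
qed

text \<open>The x-coordinate starts at \<open>x0 > 0\<close>, so by the intermediate value theorem
  it cannot become negative without vanishing.\<close>

lemma x_coord_pos:
  assumes q: "continuous_on {0..Y} q" and x0: "x0 > 0"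
    and nz: "\<forall>y\<in>{0..Y}. x_coord x0 q y \<noteq> 0" and y: "y \<in> {0..Y}"
  shows "x_coord x0 q y > 0"
proof (rule ccontr)
  assume "\<not> x_coord x0 q y > 0"
  moreover have "x_coord x0 q 0 = x0"
    using x_coord_eq_integral[OF q, of 0] y by simp
  moreover have "continuous_on {0..y} (x_coord x0 q)"
    by (rule continuous_on_subset[OF continuous_on_x_coord[OF q]]) (use y in auto)
  ultimately obtain s where "0 \<le> s" "s \<le> y" "x_coord x0 q s = 0"
    using IVT2'[of "x_coord x0 q" y 0 0] x0 y by auto
  with nz y show False by auto
qed

lemma x_coord_bounded_below:
  assumes q: "continuous_on {0..Y} q" and x0: "x0 > 0" and Y: "Y > 0"
    and nz: "\<forall>y\<in>{0..Y}. x_coord x0 q y \<noteq> 0"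
  obtains c where "c > 0" "\<And>y. y \<in> {0..Y} \<Longrightarrow> x_coord x0 q y \<ge> c"
proof -
  obtain z where "z \<in> {0..Y}" "\<forall>y\<in>{0..Y}. x_coord x0 q z \<le> x_coord x0 q y"
    using continuous_attains_inf[OF compact_Icc _ continuous_on_x_coord[OF q]] Y by fastforce
  then show ?thesis using that x_coord_pos[OF q x0 nz] by blast
qed

section \<open>Uniqueness for the initial value problem\<close>

text \<open>Monotonicity of the cube: the cofactor p^2 + pq + q^2 is half of a sum of three
  squares.\<close>

lemma cube_diff_mult_nonneg: "(p - q) * (p ^ 3 - q ^ 3) \<ge> (0::real)"
proof -
  have "(p - q) * (p ^ 3 - q ^ 3) = (p - q)\<^sup>2 * ((p + q)\<^sup>2 + p\<^sup>2 + q\<^sup>2) / 2"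
    by (simp add: power2_eq_square power3_eq_cube field_simps)
  then show ?thesis by (simp del: divide_eq_eq_numeral1 eq_divide_eq_numeral1)
qed

text \<open>The solutions are not assumed to lie in any ball and \<open>Y\<close> is not small, so
  the bounds on p, q and the lower bounds on their x-coordinates come from compactness of
  \<open>{0..Y}\<close>.\<close>

lemma ivp_solution_unique:
  assumes x0: "x0 > 0" and Y: "Y > 0" and H: "\<And>y. y \<in> {0..Y} \<Longrightarrow> \<bar>H y\<bar> \<le> B"
    and p: "ivp_solution l m n x0 H Y p" and q: "ivp_solution l m n x0 H Y q"
    and y: "y \<in> {0..Y}"
  shows "p y = q y"
proof -
  have pc: "continuous_on {0..Y} p" and qc: "continuous_on {0..Y} q"
    using p q by (auto simp: ivp_solution_def)
  obtain c1 where c1: "c1 > 0" "\<And>y. y \<in> {0..Y} \<Longrightarrow> x_coord x0 p y \<ge> c1"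
    using x_coord_bounded_below[OF pc x0 Y] p by (auto simp: ivp_solution_def)
  obtain c2 where c2: "c2 > 0" "\<And>y. y \<in> {0..Y} \<Longrightarrow> x_coord x0 q y \<ge> c2"
    using x_coord_bounded_below[OF qc x0 Y] q by (auto simp: ivp_solution_def)
  obtain R1 where R1: "R1 > 0" "\<And>y. y \<in> {0..Y} \<Longrightarrow> \<bar>p y\<bar> \<le> R1"
    using compact_imp_bounded[OF compact_continuous_image[OF pc compact_Icc]]
    by (auto simp: bounded_pos)
  obtain R2 where R2: "R2 > 0" "\<And>y. y \<in> {0..Y} \<Longrightarrow> \<bar>q y\<bar> \<le> R2"
    using compact_imp_bounded[OF compact_continuous_image[OF qc compact_Icc]]
    by (auto simp: bounded_pos)
  have B: "B \<ge> 0" using H[of 0] Y by force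
  obtain L where L: "L \<ge> 0"
    "\<And>h p q X Z. \<lbrakk>\<bar>h\<bar> \<le> B; \<bar>p\<bar> \<le> max R1 R2; \<bar>q\<bar> \<le> max R1 R2; X \<ge> min c1 c2; Z \<ge> min c1 c2\<rbrakk> \<Longrightarrow>
       \<bar>braces_regular l n h p X - braces_regular l n h q Z\<bar> \<le> L * (\<bar>p - q\<bar> + \<bar>X - Z\<bar>)"
    using braces_regular_lipschitz[of "min c1 c2" "max R1 R2" B l n thesis] c1(1) c2(1) R1(1) R2(1) B by simp
  \<comment> \<open>\<open>L * (1 + Y)\<close> will bound the growth rate of \<open>u\<close> at the
    maximum point; twice this is the rate for the square of \<open>u\<close>, and the extra 1 makes
    the final inequality strict.\<close>
  define \<kappa> where "\<kappa> = 2 * (L * (1 + Y)) + 1"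
  define u where "u = (\<lambda>y. p y - q y)"
  define \<phi> where "\<phi> = (\<lambda>y. (u y)\<^sup>2 * exp (- (\<kappa> * y)))"
  have "continuous_on {0..Y} \<phi>"
    unfolding \<phi>_def u_def using pc qc by (intro continuous_intros)
  then obtain z where z: "z \<in> {0..Y}" "\<And>s. s \<in> {0..Y} \<Longrightarrow> \<phi> s \<le> \<phi> z"
    using continuous_attains_sup[OF compact_Icc, of 0 Y \<phi>] Y by fastforce
  have "u z = 0"
  proof (rule ccontr)
    assume uz: "u z \<noteq> 0"
    moreover have "u 0 = 0" using p q by (simp add: u_def ivp_solution_def)
    ultimately have z0: "z \<in> {0<..Y}" using z(1) by (cases "z = 0") auto
    obtain d1 where d1: "(p has_real_derivative d1) (at z within {0..Y})"
        "z * d1 = - real m * p z + braces l m n x0 H p z"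
      using p z0 unfolding ivp_solution_def by blast
    obtain d2 where d2: "(q has_real_derivative d2) (at z within {0..Y})"
        "z * d2 = - real m * q z + braces l m n x0 H q z"
      using q z0 unfolding ivp_solution_def by blast
    \<comment> \<open>The exponential weight decreases, so at \<open>s\<close> it is at least as
      large as at \<open>z\<close>; maximality of \<open>\<phi>\<close> at \<open>z\<close> can then
      only hold if \<open>u\<close> is no larger at \<open>s\<close>.\<close>
    have ule: "\<bar>u s\<bar> \<le> \<bar>u z\<bar>" if s: "s \<in> {0..z}" for s
    proof -
      have "(u s)\<^sup>2 * exp (- (\<kappa> * s)) \<le> (u z)\<^sup>2 * exp (- (\<kappa> * z))"
        using z s by (auto simp: \<phi>_def)
      also have "\<dots> \<le> (u z)\<^sup>2 * exp (- (\<kappa> * s))"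
        using s L(1) Y by (intro mult_left_mono) (auto simp: \<kappa>_def intro!: mult_left_mono)
      finally show ?thesis by (simp add: abs_le_square_iff)
    qed
    define E where "E = braces_regular l n (H z) (p z) (x_coord x0 p z)
                      - braces_regular l n (H z) (q z) (x_coord x0 q z)"
    have "\<bar>x_coord x0 p z - x_coord x0 q z\<bar> \<le> \<bar>u z\<bar> * z"
      using x_coord_diff_le[OF pc qc z(1)] ule by (auto simp: u_def)
    also have "\<dots> \<le> \<bar>u z\<bar> * Y" using z by (intro mult_left_mono) auto
    finally have X: "\<bar>x_coord x0 p z - x_coord x0 q z\<bar> \<le> \<bar>u z\<bar> * Y" .
    have "\<bar>E\<bar> \<le> L * (\<bar>p z - q z\<bar> + \<bar>x_coord x0 p z - x_coord x0 q z\<bar>)"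
      unfolding E_def using H[OF z(1)] R1(2)[OF z(1)] R2(2)[OF z(1)] c1(2)[OF z(1)] c2(2)[OF z(1)]
      by (intro L(2)) auto
    also have "\<dots> \<le> L * (1 + Y) * \<bar>u z\<bar>"
      using mult_left_mono[OF X L(1)] by (simp add: u_def algebra_simps)
    finally have E: "\<bar>E\<bar> \<le> L * (1 + Y) * \<bar>u z\<bar>" .
    \<comment> \<open>Multiplying by \<open>u z\<close> turns both singular terms into nonpositive
      quantities, which are dropped. The remaining term carries the factor \<open>z\<close>, which
      cancels.\<close>
    have "z * (u z * (d1 - d2)) = u z * (z * d1 - z * d2)"
      by (simp add: algebra_simps)
    also have "\<dots> = - real m * (u z)\<^sup>2 - real m * ((p z - q z) * (p z ^ 3 - q z ^ 3)) + z * (u z * E)"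
      unfolding d1(2) d2(2) braces_eq by (simp add: E_def u_def algebra_simps power2_eq_square)
    also have "\<dots> \<le> z * (u z * E)"
    proof -
      have "real m * (u z)\<^sup>2 \<ge> 0"
        and "real m * ((p z - q z) * (p z ^ 3 - q z ^ 3)) \<ge> 0"
        using cube_diff_mult_nonneg by (auto intro: mult_nonneg_nonneg)
      then show ?thesis by linarith
    qed
    finally have "u z * (d1 - d2) \<le> u z * E" using z0 by simp
    also have "\<dots> \<le> \<bar>u z\<bar> * \<bar>E\<bar>" by (metis abs_ge_self abs_mult)
    also have "\<dots> \<le> \<bar>u z\<bar> * (L * (1 + Y) * \<bar>u z\<bar>)" using E by (intro mult_left_mono) auto
    also have "\<dots> = L * (1 + Y) * (u z)\<^sup>2" by (simp add: power2_eq_square)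
    finally have uu: "u z * (d1 - d2) \<le> L * (1 + Y) * (u z)\<^sup>2" .
    have "(\<phi> has_real_derivative
            (2 * (u z * (d1 - d2)) - \<kappa> * (u z)\<^sup>2) * exp (- (\<kappa> * z))) (at z within {0..Y})"
      unfolding \<phi>_def u_def using d1(1) d2(1)
      by (auto intro!: derivative_eq_intros simp: algebra_simps power2_eq_square)
    moreover have "(2 * (u z * (d1 - d2)) - \<kappa> * (u z)\<^sup>2) * exp (- (\<kappa> * z)) < 0"
    proof -
      have "(u z)\<^sup>2 > 0" using uz by simp
      moreover have "\<kappa> * (u z)\<^sup>2 = 2 * (L * (1 + Y) * (u z)\<^sup>2) + (u z)\<^sup>2"
        by (simp add: \<kappa>_def algebra_simps)
      ultimately have "2 * (u z * (d1 - d2)) < \<kappa> * (u z)\<^sup>2"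
        using uu by linarith
      then show ?thesis by (simp add: mult_neg_pos)
    qed
    \<comment> \<open>A negative derivative makes \<open>\<phi>\<close> larger just to the left of
      \<open>z\<close>. Looking only to the left also covers \<open>z = Y\<close>, and the step
      \<open>min z (\<delta> / 2)\<close> stays inside the interval.\<close>
    ultimately obtain \<delta> where "\<delta> > 0" and
      \<delta>: "\<And>h. \<lbrakk>0 < h; z - h \<in> {0..Y}; h < \<delta>\<rbrakk> \<Longrightarrow> \<phi> z < \<phi> (z - h)"
      using has_real_derivative_neg_dec_left by blast
    have "\<phi> z < \<phi> (z - min z (\<delta> / 2))"
      using z0 \<open>\<delta> > 0\<close> by (intro \<delta>) auto
    moreover have "\<phi> (z - min z (\<delta> / 2)) \<le> \<phi> z"
      using z0 \<open>\<delta> > 0\<close> by (intro z) auto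
    ultimately show False by simp
  qed
  then have "\<phi> y \<le> 0" using z(2)[OF y] by (simp add: \<phi>_def)
  then have "(u y)\<^sup>2 \<le> 0" by (simp add: \<phi>_def mult_le_0_iff)
  then show ?thesis by (simp add: u_def)
qed

section \<open>The ball and the integral operator\<close>

text \<open>The bound by \<open>M * y\<close> forces continuity at 0, so the weighted norm can be
  traded for pointwise bounds on continuous functions on a compact interval.\<close>

lemma X_ball_iff:
  assumes Y: "Y > 0"
  shows "q \<in> X_ball Y M \<longleftrightarrow> continuous_on {0..Y} q \<and> (\<forall>y\<in>{0..Y}. \<bar>q y\<bar> \<le> M * y)"
proof
  assume q: "q \<in> X_ball Y M"
  then have q0: "q 0 = 0" and cont: "continuous_on {0<..Y} q"
    and bdd: "bdd_above ((\<lambda>y. \<bar>q y / y\<bar>) ` {0<..Y})" and le: "X_norm Y q \<le> M"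
    by (auto simp: X_ball_def X_space_def)
  have bound: "\<bar>q y\<bar> \<le> M * y" if y: "y \<in> {0..Y}" for y
  proof (cases "y = 0")
    case False
    then have "\<bar>q y / y\<bar> \<le> X_norm Y q"
      unfolding X_norm_def using y by (intro cSUP_upper[OF _ bdd]) auto
    also note le
    finally show ?thesis using False y by (simp add: field_simps)
  qed (use q0 in simp)
  have "continuous (at y within {0..Y}) q" if y: "y \<in> {0..Y}" for y
  proof (cases "y = 0")
    case True
    have "(q \<longlongrightarrow> 0) (at 0 within {0..Y})"
    proof (rule Lim_null_comparison)
      show "\<forall>\<^sub>F y in at 0 within {0..Y}. norm (q y) \<le> M * y"
        using bound by (auto simp: eventually_at_filter)
      show "((\<lambda>y. M * y) \<longlongrightarrow> 0) (at 0 within {0..Y})"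
        by (auto intro!: tendsto_eq_intros)
    qed
    then show ?thesis using True q0 by (simp add: continuous_within)
  next
    case False
    have at_eq: "at y within {0<..Y} = at y within {0..Y}"
      by (rule at_within_nhd[where S = "{0<..}"]) (use y False in auto)
    have "continuous (at y within {0<..Y}) q"
      using cont y False by (simp add: continuous_on_eq_continuous_within)
    then show ?thesis by (simp only: at_eq)
  qed
  then show "continuous_on {0..Y} q \<and> (\<forall>y\<in>{0..Y}. \<bar>q y\<bar> \<le> M * y)"
    using bound by (auto simp: continuous_on_eq_continuous_within)
next
  assume q: "continuous_on {0..Y} q \<and> (\<forall>y\<in>{0..Y}. \<bar>q y\<bar> \<le> M * y)"
  then have "\<bar>q 0\<bar> \<le> M * 0" using Y by fastforce
  moreover have le: "\<bar>q y / y\<bar> \<le> M" if "y \<in> {0<..Y}" for y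
    using that q by (simp add: pos_divide_le_eq)
  moreover have "continuous_on {0<..Y} q"
    using q by (auto intro: continuous_on_subset)
  moreover have "X_norm Y q \<le> M"
    unfolding X_norm_def using Y le by (intro cSUP_least) auto
  ultimately show "q \<in> X_ball Y M"
    by (auto simp: X_ball_def X_space_def intro!: bdd_aboveI2[where M = M])
qed

definition integral_op ::
  "nat \<Rightarrow> nat \<Rightarrow> nat \<Rightarrow> real \<Rightarrow> (real \<Rightarrow> real) \<Rightarrow> (real \<Rightarrow> real) \<Rightarrow> real \<Rightarrow> real" where
  "integral_op l m n x0 H q y =
     inverse (y ^ m) * (LINT \<eta>:{0..y}|lebesgue. braces l m n x0 H q \<eta> * \<eta> ^ (m - 1))"

lemma x_coord_cong:
  assumes "\<And>s. s \<in> {0..y} \<Longrightarrow> p s = q s"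
  shows "x_coord x0 p y = x_coord x0 q y"
  unfolding x_coord_def using assms by (subst set_lebesgue_integral_cong) auto

lemma integral_op_cong:
  assumes "\<And>s. s \<in> {0..y} \<Longrightarrow> p s = q s"
  shows "integral_op l m n x0 H p y = integral_op l m n x0 H q y"
proof -
  have "braces l m n x0 H p s = braces l m n x0 H q s" if "s \<in> {0..y}" for s
    using assms that x_coord_cong[of s p q x0] by (simp add: braces_def)
  then show ?thesis
    unfolding integral_op_def by (subst set_lebesgue_integral_cong) auto
qed

text \<open>The integrand is at most \<open>K * y ^ m\<close> on an interval of length
  \<open>y\<close>, and dividing by \<open>y ^ m\<close> leaves \<open>K * y\<close>. The factor
  1/(m+1) from exact integration is given away.\<close>

lemma weighted_integral_bound:
  fixes f :: "real \<Rightarrow> real"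
  assumes int: "(\<lambda>\<eta>. f \<eta> * \<eta> ^ (m - 1)) integrable_on {0..y}" and m: "m \<ge> 1" and y: "y \<ge> 0"
    and f: "\<And>\<eta>. \<eta> \<in> {0..y} \<Longrightarrow> \<bar>f \<eta>\<bar> \<le> K * \<eta>" and K: "K \<ge> 0"
  shows "\<bar>inverse (y ^ m) * integral {0..y} (\<lambda>\<eta>. f \<eta> * \<eta> ^ (m - 1))\<bar> \<le> K * y"
proof (cases "y = 0")
  case False
  have "norm (integral {0..y} (\<lambda>\<eta>. f \<eta> * \<eta> ^ (m - 1))) \<le> integral {0..y} (\<lambda>_. K * y ^ m)"
  proof (rule integral_norm_bound_integral[OF int])
    fix \<eta> assume \<eta>: "\<eta> \<in> {0..y}"
    have "norm (f \<eta> * \<eta> ^ (m - 1)) \<le> K * \<eta> * \<eta> ^ (m - 1)"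
      using f[OF \<eta>] \<eta> by (auto simp: abs_mult intro!: mult_right_mono)
    also have "\<dots> = K * \<eta> ^ m"
      using m by (cases m) auto
    also have "\<dots> \<le> K * y ^ m"
      using \<eta> K by (intro mult_left_mono power_mono) auto
    finally show "norm (f \<eta> * \<eta> ^ (m - 1)) \<le> K * y ^ m" .
  qed auto
  then show ?thesis
    using y False by (simp add: abs_mult field_simps)
qed (use m in \<open>simp add: power_0_left\<close>)

section \<open>The integral operator for bounded measurable H\<close>

locale bounded_integral_equation =
  fixes l m n :: nat and x0 :: real and H :: "real \<Rightarrow> real" and Y B :: real
  assumes m_ge: "m \<ge> 1" and n_ge: "n \<ge> 1" and x0_pos: "x0 > 0" and Y_pos: "Y > 0"
    and H_measurable: "H \<in> borel_measurable (lebesgue_on {0..Y})"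
    and H_bound: "\<And>y. y \<in> {0..Y} \<Longrightarrow> \<bar>H y\<bar> \<le> B"
begin

definition admissible :: "(real \<Rightarrow> real) \<Rightarrow> bool" where
  "admissible q \<longleftrightarrow> continuous_on {0..Y} q \<and> (\<forall>y\<in>{0..Y}. x_coord x0 q y \<noteq> 0)"

lemma B_nonneg: "B \<ge> 0"
  using H_bound[of 0] Y_pos by force

text \<open>\<open>H\<close> is only measurable and bounded, so the integrand is split into
  \<open>H\<close> times a continuous function plus a continuous function.\<close>

lemma integrand_absolutely_integrable:
  assumes q: "admissible q"
  shows "(\<lambda>\<eta>. braces l m n x0 H q \<eta> * \<eta> ^ (m - 1)) absolutely_integrable_on {0..Y}"
proof -
  have qc: "continuous_on {0..Y} q" using q by (simp add: admissible_def)
  have nz: "x_coord x0 q \<eta> \<noteq> 0" if "\<eta> \<in> {0..Y}" for \<eta> using q that by (simp add: admissible_def)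
  have "(\<lambda>\<eta>. H \<eta> * ((real n - 1) * \<eta> * (1 + (q \<eta>)\<^sup>2) powr (3/2) * \<eta> ^ (m - 1)))
          absolutely_integrable_on {0..Y}"
  proof (rule absolutely_integrable_bounded_measurable_product_real[OF H_measurable])
    show "bounded (H ` {0..Y})" using H_bound by (intro boundedI[where B = B]) auto
    have "1 + (q \<eta>)\<^sup>2 \<noteq> 0" for \<eta> by (metis add_pos_nonneg less_numeral_extra(3) zero_le_power2 zero_less_one)
    then show "(\<lambda>\<eta>. (real n - 1) * \<eta> * (1 + (q \<eta>)\<^sup>2) powr (3/2) * \<eta> ^ (m - 1))
            absolutely_integrable_on {0..Y}"
      by (intro absolutely_integrable_continuous_real continuous_intros qc) auto
  qed auto
  moreover have "(\<lambda>\<eta>. (- real m * q \<eta> ^ 3 + real l * (\<eta> * (1 + (q \<eta>)\<^sup>2) / x_coord x0 q \<eta>)) * \<eta> ^ (m - 1))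
          absolutely_integrable_on {0..Y}"
    using nz by (intro absolutely_integrable_continuous_real continuous_intros qc continuous_on_x_coord) auto
  ultimately have "(\<lambda>\<eta>. H \<eta> * ((real n - 1) * \<eta> * (1 + (q \<eta>)\<^sup>2) powr (3/2) * \<eta> ^ (m - 1))
      + (- real m * q \<eta> ^ 3 + real l * (\<eta> * (1 + (q \<eta>)\<^sup>2) / x_coord x0 q \<eta>)) * \<eta> ^ (m - 1))
      absolutely_integrable_on {0..Y}"
    by (rule set_integral_add(1))
  then show ?thesis
    by (rule back_subst[where P = "\<lambda>f. f absolutely_integrable_on {0..Y}"])
      (simp add: braces_def algebra_simps)
qed

lemma integrand_integrable:
  assumes "admissible q" "y \<in> {0..Y}"
  shows "(\<lambda>\<eta>. braces l m n x0 H q \<eta> * \<eta> ^ (m - 1)) integrable_on {0..y}"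
  using set_lebesgue_integral_eq_integral(1)[OF integrand_absolutely_integrable[OF assms(1)]] assms(2)
  by (auto intro: integrable_on_subinterval)

lemma integral_op_eq:
  assumes q: "admissible q" and y: "y \<in> {0..Y}"
  shows "integral_op l m n x0 H q y =
    inverse (y ^ m) * integral {0..y} (\<lambda>\<eta>. braces l m n x0 H q \<eta> * \<eta> ^ (m - 1))"
proof -
  have "(\<lambda>\<eta>. braces l m n x0 H q \<eta> * \<eta> ^ (m - 1)) absolutely_integrable_on {0..y}"
    using y by (intro set_integrable_subset[OF integrand_absolutely_integrable[OF q]]) auto
  then show ?thesis
    by (simp add: integral_op_def set_lebesgue_integral_eq_integral(2))
qed

lemma integral_op_bound:
  assumes q: "admissible q" and y: "y \<in> {0..Y}" and K: "K \<ge> 0"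
    and le: "\<And>\<eta>. \<eta> \<in> {0..Y} \<Longrightarrow> \<bar>braces l m n x0 H q \<eta>\<bar> \<le> K * \<eta>"
  shows "\<bar>integral_op l m n x0 H q y\<bar> \<le> K * y"
  unfolding integral_op_eq[OF q y]
  using y K le m_ge by (intro weighted_integral_bound integrand_integrable q) auto

lemma integral_op_diff_bound:
  assumes p: "admissible p" and q: "admissible q" and y: "y \<in> {0..Y}" and K: "K \<ge> 0"
    and le: "\<And>\<eta>. \<eta> \<in> {0..Y} \<Longrightarrow> \<bar>braces l m n x0 H p \<eta> - braces l m n x0 H q \<eta>\<bar> \<le> K * \<eta>"
  shows "\<bar>integral_op l m n x0 H p y - integral_op l m n x0 H q y\<bar> \<le> K * y"
proof -
  let ?d = "\<lambda>\<eta>. braces l m n x0 H p \<eta> - braces l m n x0 H q \<eta>"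
  note int = integrand_integrable[OF p y] integrand_integrable[OF q y]
  have "integral_op l m n x0 H p y - integral_op l m n x0 H q y =
      inverse (y ^ m) * integral {0..y} (\<lambda>\<eta>. ?d \<eta> * \<eta> ^ (m - 1))"
    unfolding integral_op_eq[OF p y] integral_op_eq[OF q y]
    by (simp only: left_diff_distrib integral_diff[OF int] right_diff_distrib)
  moreover have "\<bar>inverse (y ^ m) * integral {0..y} (\<lambda>\<eta>. ?d \<eta> * \<eta> ^ (m - 1))\<bar> \<le> K * y"
    using y K le m_ge integrable_diff[OF int]
    by (intro weighted_integral_bound) (auto simp: left_diff_distrib)
  ultimately show ?thesis by simp
qed

text \<open>Since \<open>m \<ge> 1\<close>, the prefactor is \<open>inverse 0\<close>, which is 0 by
  default; this agrees with the convention q(0) = 0.\<close>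

lemma integral_op_0: "integral_op l m n x0 H q 0 = 0"
  using m_ge by (simp add: integral_op_def power_0_left)

lemma continuous_on_integral_op:
  assumes q: "admissible q"
  shows "continuous_on {0<..Y} (integral_op l m n x0 H q)"
proof -
  have "continuous_on {0..Y} (\<lambda>y. integral {0..y} (\<lambda>\<eta>. braces l m n x0 H q \<eta> * \<eta> ^ (m - 1)))"
    using integrand_integrable[OF q, of Y] Y_pos by (intro indefinite_integral_continuous_1) auto
  then have "continuous_on {0<..Y} (\<lambda>y. integral {0..y} (\<lambda>\<eta>. braces l m n x0 H q \<eta> * \<eta> ^ (m - 1)))"
    by (rule continuous_on_subset) auto
  then have "continuous_on {0<..Y} (\<lambda>y. inverse (y ^ m) *
      integral {0..y} (\<lambda>\<eta>. braces l m n x0 H q \<eta> * \<eta> ^ (m - 1)))"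
    by (intro continuous_intros) auto
  then show ?thesis
    using integral_op_eq[OF q] by (subst continuous_on_cong[OF refl]) auto
qed

lemma integral_op_in_X_ball:
  assumes q: "admissible q" and K: "K \<ge> 0"
    and le: "\<And>\<eta>. \<eta> \<in> {0..Y} \<Longrightarrow> \<bar>braces l m n x0 H q \<eta>\<bar> \<le> K * \<eta>"
  shows "integral_op l m n x0 H q \<in> X_ball Y K"
proof -
  have "\<bar>integral_op l m n x0 H q y / y\<bar> \<le> K" if "y \<in> {0<..Y}" for y
    using integral_op_bound[OF q _ K le, of y] that by (simp add: field_simps)
  then show ?thesis
    using Y_pos continuous_on_integral_op[OF q] integral_op_0
    by (auto simp: X_ball_def X_space_def X_norm_def intro!: bdd_aboveI2[where M = K] cSUP_least)
qed

lemma integral_eq_solution_iff: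
  assumes "q \<in> X_ball Y M"
  shows "integral_eq_solution l m n x0 H Y q \<longleftrightarrow>
    admissible q \<and> (\<forall>y\<in>{0..Y}. q y = integral_op l m n x0 H q y)"
proof -
  \<comment> \<open>The integral equation is imposed only for positive y; at 0 both sides vanish by
    convention, so the fixed point equation holds on the closed interval.\<close>
  have "q 0 = integral_op l m n x0 H q 0"
    using assms integral_op_0 by (simp add: X_ball_def X_space_def)
  moreover have "{0..Y} = insert 0 {0<..Y}" using Y_pos by auto
  ultimately show ?thesis
    using assms X_ball_iff[OF Y_pos, of q M]
    by (simp add: integral_eq_solution_def admissible_def integral_op_def)
qed

section \<open>From the integral equation to the differential equation\<close>

text \<open>Continuity of \<open>H\<close> makes the integrand continuous, so the fundamental
  theorem applies. In the product rule, differentiating the prefactor produces the term -m q /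
  y.\<close>

lemma integral_eq_solution_imp_ivp_solution:
  assumes H: "continuous_on {0..Y} H" and q: "q \<in> X_ball Y M"
    and sol: "integral_eq_solution l m n x0 H Y q"
  shows "ivp_solution l m n x0 H Y q"
proof -
  let ?f = "\<lambda>\<eta>. braces l m n x0 H q \<eta> * \<eta> ^ (m - 1)"
  have adm: "admissible q" and eq: "\<And>y. y \<in> {0..Y} \<Longrightarrow> q y = integral_op l m n x0 H q y"
    using sol integral_eq_solution_iff[OF q] by auto
  have qc: "continuous_on {0..Y} q" and nz: "\<And>y. y \<in> {0..Y} \<Longrightarrow> x_coord x0 q y \<noteq> 0"
    using adm by (auto simp: admissible_def)
  have "1 + (q \<eta>)\<^sup>2 \<noteq> 0" for \<eta> by (metis add_pos_nonneg less_numeral_extra(3) zero_le_power2 zero_less_one)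
  then have fc: "continuous_on {0..Y} ?f"
    unfolding braces_def using nz by (intro continuous_intros qc H continuous_on_x_coord) auto
  have "\<exists>d. (q has_real_derivative d) (at y within {0..Y}) \<and>
          y * d = - real m * q y + braces l m n x0 H q y" if y: "y \<in> {0<..Y}" for y
  proof (intro exI conjI)
    let ?J = "\<lambda>y. integral {0..y} ?f"
    let ?d = "- (real m * y ^ (m - 1) * inverse (y ^ m) * inverse (y ^ m)) * ?J y + inverse (y ^ m) * ?f y"
    have "(?J has_real_derivative ?f y) (at y within {0..Y})"
      using fc y by (intro integral_has_real_derivative) auto
    then have der: "((\<lambda>y. inverse (y ^ m) * ?J y) has_real_derivative ?d) (at y within {0..Y})"
      using y by (auto intro!: derivative_eq_intros simp: algebra_simps)
    show "(q has_real_derivative ?d) (at y within {0..Y})"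
      by (rule has_field_derivative_transform_within[OF der zero_less_one])
        (use y eq integral_op_eq[OF adm] in auto)
    \<comment> \<open>The truncated exponent \<open>m - 1\<close> is harmless because
      \<open>m \<ge> 1\<close>. This single cancellation simplifies both terms of
      \<open>y * ?d\<close>.\<close>
    have pow: "y * y ^ (m - 1) * inverse (y ^ m) = 1" using m_ge y by (cases m) (auto simp: field_simps)
    have "y * ?d = - real m * (inverse (y ^ m) * ?J y) * (y * y ^ (m - 1) * inverse (y ^ m))
        + braces l m n x0 H q y * (y * y ^ (m - 1) * inverse (y ^ m))"
      by (simp only: algebra_simps mult_minus_left mult_minus_right)
    also have "\<dots> = - real m * q y + braces l m n x0 H q y"
      unfolding pow using y eq[of y] integral_op_eq[OF adm, of y] by simp
    finally show "y * ?d = - real m * q y + braces l m n x0 H q y" .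
  qed
  then show ?thesis
    using qc nz q by (auto simp: ivp_solution_def X_ball_def X_space_def)
qed

section \<open>Self-map and contraction on a short interval\<close>

text \<open>There is no circularity in the constants: \<open>L\<close> belongs to the bounds 1 on
  |q| and \<open>x0 / 2\<close> on the x-coordinate, \<open>growth\<close> fixes \<open>M\<close>
  from the data, and the conditions on \<open>Y\<close> then hold for all small
  \<open>Y\<close>.\<close>

context
  fixes M L :: real
  assumes M_nonneg: "M \<ge> 0" and L_nonneg: "L \<ge> 0" and Y_le_1: "Y \<le> 1"
    and MY_le_1: "M * Y \<le> 1" and MY_le_x0: "M * Y \<le> x0 / 2"
    and cube_le_1: "real m * M ^ 3 * Y \<le> 1"
    and growth: "(real n - 1) * B * 4 + real l * (4 / x0) + 1 \<le> M"
    and contraction: "(3 * real m * M + 2 * L) * Y \<le> 1 / 2"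
    and lipschitz: "\<And>h p q X Z. \<lbrakk>\<bar>h\<bar> \<le> B; \<bar>p\<bar> \<le> 1; \<bar>q\<bar> \<le> 1; X \<ge> x0 / 2; Z \<ge> x0 / 2\<rbrakk> \<Longrightarrow>
       \<bar>braces_regular l n h p X - braces_regular l n h q Z\<bar> \<le> L * (\<bar>p - q\<bar> + \<bar>X - Z\<bar>)"
begin

lemma X_ball_abs_le_1:
  assumes "q \<in> X_ball Y M" "y \<in> {0..Y}"
  shows "\<bar>q y\<bar> \<le> 1"
proof -
  have "\<bar>q y\<bar> \<le> M * y" using assms X_ball_iff[OF Y_pos] by blast
  also have "\<dots> \<le> M * Y" using assms M_nonneg by (intro mult_left_mono) auto
  finally show ?thesis using MY_le_1 by linarith
qed

lemma x_coord_X_ball: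
  assumes q: "q \<in> X_ball Y M" and y: "y \<in> {0..Y}"
  shows "x_coord x0 q y \<ge> x0 / 2"
proof -
  \<comment> \<open>Comparison with the zero function, whose x-coordinate is constantly
    \<open>x0\<close>.\<close>
  have "\<bar>x_coord x0 q y - x_coord x0 (\<lambda>_. 0) y\<bar> \<le> (M * Y) * y"
  proof (rule x_coord_diff_le[OF _ _ y])
    fix s assume "s \<in> {0..y}"
    then have "\<bar>q s\<bar> \<le> M * s" "M * s \<le> M * Y"
      using q y M_nonneg X_ball_iff[OF Y_pos, of q M] by (auto intro: mult_left_mono)
    then show "\<bar>q s - 0\<bar> \<le> M * Y" by simp
  qed (use q X_ball_iff[OF Y_pos] in auto)
  also have "\<dots> \<le> M * Y * 1"
    using y Y_le_1 M_nonneg Y_pos by (intro mult_left_mono) auto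
  finally show ?thesis using MY_le_x0 by (simp add: x_coord_def)
qed

lemma X_ball_admissible: "q \<in> X_ball Y M \<Longrightarrow> admissible q"
  using x_coord_X_ball[of q] X_ball_iff[OF Y_pos, of q M] x0_pos
  by (force simp: admissible_def)

text \<open>The cubic term is of order y^3 on the ball and contributes at most \<open>y\<close>; the
  regular part contributes at most \<open>(M - 1) * y\<close>, which is the purpose of the summand 1
  in \<open>growth\<close>.\<close>

lemma braces_bound:
  assumes q: "q \<in> X_ball Y M" and y: "y \<in> {0..Y}"
  shows "\<bar>braces l m n x0 H q y\<bar> \<le> M * y"
proof -
  let ?X = "x_coord x0 q y"
  have X: "?X \<ge> x0 / 2" by (rule x_coord_X_ball[OF q y])
  have q1: "\<bar>q y\<bar> \<le> 1" by (rule X_ball_abs_le_1[OF q y])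
  then have q2: "(q y)\<^sup>2 \<le> 1" by (simp add: abs_square_le_1)
  have "real m * \<bar>q y\<bar> ^ 3 \<le> real m * (M * y) ^ 3"
    using q y X_ball_iff[OF Y_pos] by (intro mult_left_mono power_mono) auto
  also have "\<dots> = real m * M ^ 3 * y\<^sup>2 * y" by (simp add: power2_eq_square power3_eq_cube)
  also have "\<dots> \<le> real m * M ^ 3 * Y * y"
  proof (intro mult_right_mono mult_left_mono)
    have "y * y \<le> Y * 1" using y Y_le_1 by (intro mult_mono) auto
    then show "y\<^sup>2 \<le> Y" by (simp add: power2_eq_square)
  qed (use y M_nonneg in auto)
  also have "\<dots> \<le> 1 * y" using y by (intro mult_right_mono cube_le_1) auto
  finally have cube: "real m * \<bar>q y\<bar> ^ 3 \<le> y" by simp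
  \<comment> \<open>From here to \<open>qt\<close> the constants 4 and \<open>4 / x0\<close> of
    \<open>growth\<close> arise, using |q| at most 1 and an x-coordinate of at least
    \<open>x0 / 2\<close>.\<close>
  have "(1 + (q y)\<^sup>2) powr (3/2) \<le> 2 powr (3/2)" using q2 by (intro powr_mono2) auto
  also have "\<dots> \<le> 2 powr 2" by (intro powr_mono) auto
  finally have pw: "(1 + (q y)\<^sup>2) powr (3/2) \<le> 4" by simp
  have "(1 + (q y)\<^sup>2) / ?X \<le> 2 / (x0 / 2)" using q2 X x0_pos by (intro frac_le) auto
  moreover have "(1 + (q y)\<^sup>2) / ?X \<ge> 0" using X x0_pos by (intro divide_nonneg_nonneg) auto
  ultimately have qt: "\<bar>(1 + (q y)\<^sup>2) / ?X\<bar> \<le> 4 / x0" by simp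
  have "\<bar>braces_regular l n (H y) (q y) ?X\<bar>
      \<le> (real n - 1) * \<bar>H y\<bar> * (1 + (q y)\<^sup>2) powr (3/2) + real l * \<bar>(1 + (q y)\<^sup>2) / ?X\<bar>"
    unfolding braces_regular_def using n_ge
    by (intro order.trans[OF abs_triangle_ineq] add_mono) (simp_all add: abs_mult)
  also have "\<dots> \<le> (real n - 1) * B * 4 + real l * (4 / x0)"
    using n_ge B_nonneg H_bound[OF y] pw qt by (intro add_mono mult_mono) auto
  also have "\<dots> \<le> M - 1" using growth by simp
  finally have reg: "\<bar>braces_regular l n (H y) (q y) ?X\<bar> \<le> M - 1" .
  have "\<bar>braces l m n x0 H q y\<bar> \<le> real m * \<bar>q y\<bar> ^ 3 + y * \<bar>braces_regular l n (H y) (q y) ?X\<bar>"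
    unfolding braces_eq using y
    by (intro order.trans[OF abs_triangle_ineq] add_mono) (simp_all add: abs_mult power_abs)
  also have "\<dots> \<le> y + y * (M - 1)"
    using cube reg y by (intro add_mono mult_left_mono) auto
  finally show ?thesis by (simp add: algebra_simps)
qed

text \<open>An unweighted bound \<open>D\<close> on p - q still yields a factor \<open>y\<close>: in
  the difference of cubes the quadratic cofactor is O(y) on the ball, and the regular part carries
  \<open>y\<close> explicitly. The two summands of \<open>2 * L\<close> stem from p - q and from the
  x-coordinates.\<close>

lemma braces_diff_bound:
  assumes p: "p \<in> X_ball Y M" and q: "q \<in> X_ball Y M" and y: "y \<in> {0..Y}"
    and D: "\<And>s. s \<in> {0..Y} \<Longrightarrow> \<bar>p s - q s\<bar> \<le> D"
  shows "\<bar>braces l m n x0 H p y - braces l m n x0 H q y\<bar> \<le> (3 * real m * M + 2 * L) * D * y"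
proof -
  let ?X = "x_coord x0 p y" and ?Z = "x_coord x0 q y"
  let ?E = "braces_regular l n (H y) (p y) ?X - braces_regular l n (H y) (q y) ?Z"
  have pq1: "\<bar>p y\<bar> \<le> 1" "\<bar>q y\<bar> \<le> 1" using X_ball_abs_le_1 p q y by auto
  have pqM: "\<bar>p y\<bar> \<le> M * y" "\<bar>q y\<bar> \<le> M * y" using p q y X_ball_iff[OF Y_pos] by auto
  have D0: "D \<ge> 0" using D[OF y] by linarith
  have prod: "\<bar>a * b\<bar> \<le> M * y" if "\<bar>a\<bar> \<le> M * y" "\<bar>b\<bar> \<le> 1" for a b
    using mult_mono[OF that] M_nonneg y by (simp add: abs_mult)
  have quad: "\<bar>p y * p y + p y * q y + q y * q y\<bar> \<le> 3 * (M * y)"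
    using prod[OF pqM(1) pq1(1)] prod[OF pqM(1) pq1(2)] prod[OF pqM(2) pq1(2)] by linarith
  have "p y ^ 3 - q y ^ 3 = (p y - q y) * (p y * p y + p y * q y + q y * q y)"
    by (simp add: power3_eq_cube algebra_simps)
  also have "\<bar>\<dots>\<bar> \<le> D * (3 * (M * y))"
    unfolding abs_mult[of "p y - q y"] using D[OF y] D0 quad by (intro mult_mono) auto
  finally have cube: "\<bar>p y ^ 3 - q y ^ 3\<bar> \<le> D * (3 * (M * y))" .
  have "\<bar>?X - ?Z\<bar> \<le> D * y"
    using p q y D X_ball_iff[OF Y_pos] by (intro x_coord_diff_le[where Y = Y]) auto
  also have "\<dots> \<le> D * 1" using y Y_le_1 D0 by (intro mult_left_mono) auto
  finally have X: "\<bar>?X - ?Z\<bar> \<le> D" by simp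
  have "\<bar>?E\<bar> \<le> L * (\<bar>p y - q y\<bar> + \<bar>?X - ?Z\<bar>)"
    using H_bound y p q pq1 x_coord_X_ball by (intro lipschitz) auto
  also have "\<dots> \<le> L * (D + D)"
    using X D[OF y] L_nonneg by (intro mult_left_mono add_mono) auto
  finally have E: "\<bar>?E\<bar> \<le> L * (D + D)" .
  have "braces l m n x0 H p y - braces l m n x0 H q y = - real m * (p y ^ 3 - q y ^ 3) + y * ?E"
    by (simp add: braces_eq algebra_simps)
  also have "\<bar>\<dots>\<bar> \<le> real m * \<bar>p y ^ 3 - q y ^ 3\<bar> + y * \<bar>?E\<bar>"
    using y by (intro order.trans[OF abs_triangle_ineq] add_mono) (simp_all add: abs_mult)
  also have "\<dots> \<le> real m * (D * (3 * (M * y))) + y * (L * (D + D))"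
    using cube E y by (intro add_mono mult_left_mono) auto
  finally show ?thesis by (simp add: algebra_simps)
qed

lemma integral_op_contraction:
  assumes p: "p \<in> X_ball Y M" and q: "q \<in> X_ball Y M" and y: "y \<in> {0..Y}"
    and D: "\<And>s. s \<in> {0..Y} \<Longrightarrow> \<bar>p s - q s\<bar> \<le> D"
  shows "\<bar>integral_op l m n x0 H p y - integral_op l m n x0 H q y\<bar> \<le> 1 / 2 * D"
proof -
  let ?K = "3 * real m * M + 2 * L"
  have D0: "D \<ge> 0" using D[OF y] by linarith
  have K0: "?K \<ge> 0" using M_nonneg L_nonneg by simp
  have "\<bar>integral_op l m n x0 H p y - integral_op l m n x0 H q y\<bar> \<le> ?K * D * y"
    using K0 D0 braces_diff_bound[OF p q _ D]
    by (intro integral_op_diff_bound X_ball_admissible p q y) auto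
  also have "\<dots> \<le> ?K * D * Y" using y K0 D0 by (intro mult_left_mono) auto
  also have "\<dots> = (?K * Y) * D" by simp
  also have "\<dots> \<le> 1 / 2 * D" by (intro mult_right_mono contraction D0)
  finally show ?thesis .
qed

section \<open>The fixed point\<close>

lemma unique_integral_eq_solution_exists: "\<exists>q. unique_integral_eq_solution l m n x0 H Y M q"
proof -
  \<comment> \<open>Clamping to \<open>{0..Y}\<close> extends functions on the interval to bounded
    continuous functions on the whole line, where the supremum metric is complete.\<close>
  define r where "r = (\<lambda>t::real. max 0 (min Y t))"
  have r: "r t \<in> {0..Y}" "t \<in> {0..Y} \<Longrightarrow> r t = t" for t
    using Y_pos by (auto simp: r_def)
  have r_cont: "continuous_on UNIV r" unfolding r_def by (intro continuous_intros)
  have ext: "(\<lambda>t. q (r t)) \<in> bcontfun" if q: "q \<in> X_ball Y M" for q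
  proof -
    have "continuous_on UNIV (\<lambda>t. q (r t))"
      using q r X_ball_iff[OF Y_pos, of q M]
      by (intro continuous_on_compose2[OF _ r_cont, of "{0..Y}" q]) auto
    moreover have "\<bar>q (r t)\<bar> \<le> 1" for t by (rule X_ball_abs_le_1[OF q r(1)])
    then have "bounded (range (\<lambda>t. q (r t)))" by (intro boundedI[where B = 1]) auto
    ultimately show ?thesis by (simp add: bcontfun_def)
  qed
  \<comment> \<open>The ball as a set of pointwise constraints, which is closed in the supremum
    metric. Values outside \<open>{0..Y}\<close> are left free; \<open>T\<close> makes them constant
    on each side.\<close>
  define S :: "(real \<Rightarrow>\<^sub>C real) set" where "S = PiC {0..Y} (\<lambda>y. {- (M * y)..M * y})"
  define T where "T = (\<lambda>g :: real \<Rightarrow>\<^sub>C real. Bcontfun (\<lambda>t. integral_op l m n x0 H (apply_bcontfun g) (r t)))"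
  have S_iff: "g \<in> S \<longleftrightarrow> apply_bcontfun g \<in> X_ball Y M" for g
    unfolding S_def mem_PiC_iff X_ball_iff[OF Y_pos]
    by (force simp: Pi_iff abs_le_iff continuous_on_apply_bcontfun)
  have op_ball: "integral_op l m n x0 H q \<in> X_ball Y M" if "q \<in> X_ball Y M" for q
    using that M_nonneg by (intro integral_op_in_X_ball X_ball_admissible braces_bound)
  have T_apply: "apply_bcontfun (T g) t = integral_op l m n x0 H (apply_bcontfun g) (r t)" if "g \<in> S" for g t
    unfolding T_def using Bcontfun_inverse[OF ext[OF op_ball]] that S_iff by simp
  have "\<exists>!g\<in>S. T g = g"
  proof (rule Banach_fix[where c = "1/2"])
    show "complete S" unfolding S_def complete_eq_closed by (intro closed_PiC) auto
    have "(0 :: real \<Rightarrow>\<^sub>C real) \<in> S"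
      unfolding S_def mem_PiC_iff using M_nonneg by (auto simp: Pi_iff)
    then show "S \<noteq> {}" by blast
    show "T ` S \<subseteq> S"
    proof safe
      fix g assume g: "g \<in> S"
      have "integral_op l m n x0 H (apply_bcontfun g) \<in> X_ball Y M" using op_ball g S_iff by blast
      then show "T g \<in> S"
        unfolding S_def mem_PiC_iff X_ball_iff[OF Y_pos]
        by (force simp: Pi_iff T_apply[OF g] r abs_le_iff)
    qed
    fix f g assume fg: "f \<in> S" "g \<in> S"
    show "dist (T f) (T g) \<le> 1 / 2 * dist f g"
    proof (rule dist_bound)
      fix t
      show "dist (apply_bcontfun (T f) t) (apply_bcontfun (T g) t) \<le> 1 / 2 * dist f g"
        unfolding T_apply[OF fg(1)] T_apply[OF fg(2)] dist_real_def
        using fg S_iff r(1) dist_bounded[of f _ g]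
        by (intro integral_op_contraction) (auto simp: dist_real_def)
    qed
  qed auto
  then obtain g where g: "g \<in> S" "T g = g" and g_unique: "\<And>f. \<lbrakk>f \<in> S; T f = f\<rbrakk> \<Longrightarrow> f = g"
    by blast
  have g_ball: "apply_bcontfun g \<in> X_ball Y M" using g(1) S_iff by blast
  show ?thesis
    unfolding unique_integral_eq_solution_def
  proof (intro exI[of _ "apply_bcontfun g"] conjI ballI impI g_ball)
    have "apply_bcontfun g y = integral_op l m n x0 H (apply_bcontfun g) y" if "y \<in> {0..Y}" for y
      using T_apply[OF g(1), of y] g(2) r(2)[OF that] by simp
    then show "integral_eq_solution l m n x0 H Y (apply_bcontfun g)"
      using integral_eq_solution_iff[OF g_ball] X_ball_admissible[OF g_ball] by blast
  next
    fix p y assume p: "p \<in> X_ball Y M" and sol: "integral_eq_solution l m n x0 H Y p" and y: "y \<in> {0..Y}"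
    \<comment> \<open>A competing solution, once clamped, is itself a fixed point of
      \<open>T\<close> in \<open>S\<close>, so it coincides with \<open>g\<close>.\<close>
    define f where "f = Bcontfun (\<lambda>t. p (r t))"
    have f_apply: "apply_bcontfun f t = p (r t)" for t
      unfolding f_def by (simp add: Bcontfun_inverse[OF ext[OF p]])
    have fS: "f \<in> S"
      using p unfolding S_def mem_PiC_iff X_ball_iff[OF Y_pos]
      by (force simp: Pi_iff f_apply r abs_le_iff)
    have "apply_bcontfun (T f) t = apply_bcontfun f t" for t
    proof -
      have "apply_bcontfun (T f) t = integral_op l m n x0 H p (r t)"
        unfolding T_apply[OF fS] using r(1)[of t] by (intro integral_op_cong) (auto simp: f_apply r)
      also have "\<dots> = p (r t)" using sol r(1) integral_eq_solution_iff[OF p] by simp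
      finally show ?thesis by (simp add: f_apply)
    qed
    then have "f = g" using fS by (intro g_unique bcontfun_eqI)
    then show "p y = apply_bcontfun g y" using f_apply[of y] r(2)[OF y] by simp
  qed
qed

end

end

section \<open>Choice of the constants and conclusion\<close>

lemma integral_equation_unique_solution:
  fixes l m n :: nat and x0 Y0 B :: real and H :: "real \<Rightarrow> real"
  assumes m: "m \<ge> 1" and n: "n \<ge> 1" and x0: "x0 > 0" and Y0: "Y0 > 0"
    and H: "H \<in> borel_measurable (lebesgue_on {0..Y0})"
    and B: "\<And>y. y \<in> {0..Y0} \<Longrightarrow> \<bar>H y\<bar> \<le> B"
  shows "\<exists>M>0. \<exists>Y\<in>{0<..Y0}. \<exists>q. unique_integral_eq_solution l m n x0 H Y M q"
proof -
  have B0: "B \<ge> 0" using B[of 0] Y0 by force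
  obtain L where L: "L \<ge> 0"
    "\<And>h p q X Z. \<lbrakk>\<bar>h\<bar> \<le> B; \<bar>p\<bar> \<le> 1; \<bar>q\<bar> \<le> 1; X \<ge> x0 / 2; Z \<ge> x0 / 2\<rbrakk> \<Longrightarrow>
       \<bar>braces_regular l n h p X - braces_regular l n h q Z\<bar> \<le> L * (\<bar>p - q\<bar> + \<bar>X - Z\<bar>)"
    using braces_regular_lipschitz[of "x0 / 2" 1 B l n thesis] x0 B0 by simp
  define M where "M = (real n - 1) * B * 4 + real l * (4 / x0) + 1"
  have M: "M > 0" using n B0 x0 by (auto simp: M_def intro!: add_nonneg_pos)
  \<comment> \<open>Each smallness condition has the form c * Y \<le> 1 after scaling.
    \<open>K\<close> is the sum of these nonnegative c, so \<open>Y \<le> 1 / K\<close> meets all of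
    them.\<close>
  define K where "K = 1 + M + 2 * M / x0 + real m * M ^ 3 + 2 * (3 * real m * M + 2 * L)"
  define Y where "Y = min Y0 (1 / K)"
  have terms: "M \<ge> 0" "2 * M / x0 \<ge> 0" "real m * M ^ 3 \<ge> 0" "2 * (3 * real m * M + 2 * L) \<ge> 0"
    using M L(1) x0 by auto
  then have K: "K > 0" unfolding K_def by linarith
  have Y: "Y > 0" "Y \<le> Y0" using K Y0 by (auto simp: Y_def)
  have small: "c * Y \<le> 1" if "c \<le> K" for c
  proof -
    have "c * Y \<le> K * Y" using that Y by (intro mult_right_mono) auto
    also have "\<dots> \<le> K * (1 / K)" using K by (intro mult_left_mono) (auto simp: Y_def)
    finally show ?thesis using K by simp
  qed
  interpret bounded_integral_equation l m n x0 H Y B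
  proof
    show "H \<in> borel_measurable (lebesgue_on {0..Y})"
      using Y by (intro measurable_restrict_mono[OF H]) auto
  qed (use m n x0 Y B in auto)
  have "\<exists>q. unique_integral_eq_solution l m n x0 H Y M q"
  proof (rule unique_integral_eq_solution_exists[where L = L])
    show "Y \<le> 1" using small[of 1] terms by (simp add: K_def)
    show "M * Y \<le> 1" using terms by (intro small) (simp add: K_def)
    have "2 * M / x0 * Y \<le> 1" using terms by (intro small) (simp add: K_def)
    then show "M * Y \<le> x0 / 2" using x0 by (simp add: field_simps)
    show "real m * M ^ 3 * Y \<le> 1" using terms by (intro small) (simp add: K_def)
    have "2 * (3 * real m * M + 2 * L) * Y \<le> 1" using terms by (intro small) (simp add: K_def)
    then show "(3 * real m * M + 2 * L) * Y \<le> 1 / 2" by linarith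
  qed (use M L in \<open>auto simp: M_def\<close>)
  then show ?thesis using M Y by (intro exI[of _ M] conjI bexI[of _ Y]) auto
qed

theorem proposition4p2:
  fixes l m n :: nat and x0 Y0 :: real and H :: "real \<Rightarrow> real"
  assumes "l \<ge> 1" and "m \<ge> 1" and "n = l + m + 2"
    and "x0 > 0" and "Y0 > 0"
    and "H \<in> borel_measurable (lebesgue_on {0..Y0})"
  shows "(bounded (H ` {0..Y0}) \<longrightarrow>
            (\<exists>M>0. \<exists>Y\<in>{0<..Y0}. \<exists>q. unique_integral_eq_solution l m n x0 H Y M q))
       \<and> (bounded (H ` {0..Y0}) \<and> continuous_on {0..Y0} H \<longrightarrow>
            (\<forall>M>0. \<forall>Y\<in>{0<..Y0}. \<forall>q. unique_integral_eq_solution l m n x0 H Y M q \<longrightarrow>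
               unique_ivp_solution l m n x0 H Y q))"
proof (intro conjI impI allI ballI)
  assume "bounded (H ` {0..Y0})"
  then obtain B where "\<And>y. y \<in> {0..Y0} \<Longrightarrow> \<bar>H y\<bar> \<le> B"
    unfolding bounded_iff by (metis imageI real_norm_def)
  then show "\<exists>M>0. \<exists>Y\<in>{0<..Y0}. \<exists>q. unique_integral_eq_solution l m n x0 H Y M q"
    using assms by (intro integral_equation_unique_solution) auto
next
  fix M Y :: real and q
  assume H: "bounded (H ` {0..Y0}) \<and> continuous_on {0..Y0} H" and Y: "Y \<in> {0<..Y0}"
    and q: "unique_integral_eq_solution l m n x0 H Y M q"
  obtain B where B: "\<And>y. y \<in> {0..Y0} \<Longrightarrow> \<bar>H y\<bar> \<le> B"
    using H unfolding bounded_iff by (metis imageI real_norm_def)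
  \<comment> \<open>\<open>M\<close> and \<open>Y\<close> are arbitrary here, so only the facts
    established before the smallness conditions are available.\<close>
  interpret bounded_integral_equation l m n x0 H Y B
  proof
    show "H \<in> borel_measurable (lebesgue_on {0..Y})"
      using Y by (intro measurable_restrict_mono[OF assms(6)]) auto
  qed (use assms Y B in auto)
  have "continuous_on {0..Y} H"
    using H Y by (auto intro: continuous_on_subset)
  then have "ivp_solution l m n x0 H Y q"
    using q integral_eq_solution_imp_ivp_solution by (auto simp: unique_integral_eq_solution_def)
  then show "unique_ivp_solution l m n x0 H Y q"
    using ivp_solution_unique[OF x0_pos Y_pos H_bound] by (auto simp: unique_ivp_solution_def)
qed

end
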